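(* Let $m,n\geq2$ be integers such that neither is a multiple of the other. Then the link quandle of the torus link $T(m,n)$ is not right-orderable.
   Context: The torus link $T(m,n)$ is the closure of the $m$-strand braid $(\sigma_1\sigma_2\cdots\sigma_{m-1})^n$, with all strands oriented in parallel. A quandle is a non-empty set $Q$ with a binary operation $*$ such that $x*x=x$; for all $x,y$ there is a unique $z$ (denoted $x*^{-1}y$) with $x=z*y$; and $(x*y)*z=(x*z)*(y*z)$. $Q$ is right-orderable if it has a (strict) linear order $<$ such that $x<y$ implies $x*z<y*z$ for all $x,y,z\in Q$. The link quandle of an oriented link in the 3-sphere is the quandle presented by generators the arcs of a diagram and one relation per crossing: if $y$ is the over arc and $x$, $z$ are the incoming and outgoing under arcs, then $z=x*y$ if the crossing is positive and $z=x*^{-1}y$ if it is negative; up to isomorphism it does not depend on the diagram. *)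

theory Defs
  imports "HOL-Algebra.Congruence"
begin

section \<open>Quandles\<close>

record 'a quandle_struct = "'a partial_object" +
  qop :: "'a \<Rightarrow> 'a \<Rightarrow> 'a"  (infixl \<open>\<star>\<index>\<close> 70)

locale quandle =
  fixes Q :: "('a, 'b) quandle_struct_scheme" (structure)
  assumes nonempty: "carrier Q \<noteq> {}"
    and closed: "\<lbrakk> x \<in> carrier Q; y \<in> carrier Q \<rbrakk> \<Longrightarrow> x \<star> y \<in> carrier Q"
    and idem: "x \<in> carrier Q \<Longrightarrow> x \<star> x = x"
    and right_div: "\<lbrakk> x \<in> carrier Q; y \<in> carrier Q \<rbrakk> \<Longrightarrow> \<exists>!z. z \<in> carrier Q \<and> x = z \<star> y"
    and distrib: "\<lbrakk> x \<in> carrier Q; y \<in> carrier Q; z \<in> carrier Q \<rbrakk>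
                   \<Longrightarrow> (x \<star> y) \<star> z = (x \<star> z) \<star> (y \<star> z)"

definition quandle_inv :: "('a, 'b) quandle_struct_scheme \<Rightarrow> 'a \<Rightarrow> 'a \<Rightarrow> 'a" where
  "quandle_inv Q x y = (THE z. z \<in> carrier Q \<and> x = z \<star>\<^bsub>Q\<^esub> y)"

definition right_orderable :: "('a, 'b) quandle_struct_scheme \<Rightarrow> bool" where
  "right_orderable Q \<longleftrightarrow>
     (\<exists>r. r \<subseteq> carrier Q \<times> carrier Q \<and> strict_linear_order_on (carrier Q) r \<and>
        (\<forall>x\<in>carrier Q. \<forall>y\<in>carrier Q. \<forall>z\<in>carrier Q.
           (x, y) \<in> r \<longrightarrow> (x \<star>\<^bsub>Q\<^esub> z, y \<star>\<^bsub>Q\<^esub> z) \<in> r))"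


section \<open>Quandle presentations\<close>

datatype 'a qterm = QGen 'a | QMul "'a qterm" "'a qterm" | QInv "'a qterm" "'a qterm"

definition qterms :: "'a set \<Rightarrow> 'a qterm set" where
  "qterms X = {t. set_qterm t \<subseteq> X}"

text \<open>The least congruence on terms over \<open>X\<close> that contains the relations \<open>R\<close> and whose
  quotient is a quandle. The two cancellation rules say that \<open>QInv x y\<close> is the
  unique \<open>z\<close> with \<open>x = z \<star> y\<close>.\<close>

inductive_set qcong :: "'a set \<Rightarrow> ('a qterm \<times> 'a qterm) set \<Rightarrow> ('a qterm \<times> 'a qterm) set"
  for X :: "'a set" and R :: "('a qterm \<times> 'a qterm) set" where
  rel: "\<lbrakk> (s, t) \<in> R; s \<in> qterms X; t \<in> qterms X \<rbrakk> \<Longrightarrow> (s, t) \<in> qcong X R"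
| refl: "t \<in> qterms X \<Longrightarrow> (t, t) \<in> qcong X R"
| sym: "(s, t) \<in> qcong X R \<Longrightarrow> (t, s) \<in> qcong X R"
| trans: "\<lbrakk> (s, t) \<in> qcong X R; (t, u) \<in> qcong X R \<rbrakk> \<Longrightarrow> (s, u) \<in> qcong X R"
| cong_mul: "\<lbrakk> (s, s') \<in> qcong X R; (t, t') \<in> qcong X R \<rbrakk>
              \<Longrightarrow> (QMul s t, QMul s' t') \<in> qcong X R"
| cong_inv: "\<lbrakk> (s, s') \<in> qcong X R; (t, t') \<in> qcong X R \<rbrakk>
              \<Longrightarrow> (QInv s t, QInv s' t') \<in> qcong X R"
| idem: "s \<in> qterms X \<Longrightarrow> (QMul s s, s) \<in> qcong X R"
| inv_mul: "\<lbrakk> s \<in> qterms X; t \<in> qterms X \<rbrakk> \<Longrightarrow> (QMul (QInv s t) t, s) \<in> qcong X R"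
| mul_inv: "\<lbrakk> s \<in> qterms X; t \<in> qterms X \<rbrakk> \<Longrightarrow> (QInv (QMul s t) t, s) \<in> qcong X R"
| distrib: "\<lbrakk> s \<in> qterms X; t \<in> qterms X; u \<in> qterms X \<rbrakk>
             \<Longrightarrow> (QMul (QMul s t) u, QMul (QMul s u) (QMul t u)) \<in> qcong X R"

definition presented_quandle ::
    "'a set \<Rightarrow> ('a qterm \<times> 'a qterm) set \<Rightarrow> 'a qterm set quandle_struct" where
  "presented_quandle X R =
     \<lparr> carrier = qterms X // qcong X R,
       qop = (\<lambda>A B. \<Union>s\<in>A. \<Union>t\<in>B. qcong X R `` {QMul s t}) \<rparr>"

lemma qterms_simps [simp]:
  "QGen a \<in> qterms X \<longleftrightarrow> a \<in> X"
  "QMul s t \<in> qterms X \<longleftrightarrow> s \<in> qterms X \<and> t \<in> qterms X"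
  "QInv s t \<in> qterms X \<longleftrightarrow> s \<in> qterms X \<and> t \<in> qterms X"
  by (auto simp: qterms_def)

lemma qcong_qterms: "(s, t) \<in> qcong X R \<Longrightarrow> s \<in> qterms X \<and> t \<in> qterms X"
  by (induction rule: qcong.induct) auto

lemma equiv_qcong: "equiv (qterms X) (qcong X R)"
  by (rule equivI)
     (auto intro!: refl_onI symI transI dest: qcong_qterms intro: qcong.refl qcong.sym qcong.trans)

lemma presented_qop:
  assumes "s \<in> qterms X" "t \<in> qterms X"
  shows "qcong X R `` {s} \<star>\<^bsub>presented_quandle X R\<^esub> qcong X R `` {t} = qcong X R `` {QMul s t}"
proof -
  have "congruent2 (qcong X R) (qcong X R) (\<lambda>s t. qcong X R `` {QMul s t})"
    by (rule congruent2I')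
       (use equiv_class_eq[OF equiv_qcong] qcong.cong_mul in blast)
  from UN_equiv_class2[OF equiv_qcong equiv_qcong this assms] show ?thesis
    by (simp add: presented_quandle_def)
qed

lemma presented_quandle_quandle:
  assumes "X \<noteq> {}"
  shows "quandle (presented_quandle X R)"
proof -
  let ?P = "presented_quandle X R" and ?c = "\<lambda>t. qcong X R `` {t}"
  have car: "carrier ?P = ?c ` qterms X"
    by (auto simp: presented_quandle_def quotient_def)
  have eq: "?c s = ?c t \<longleftrightarrow> (s, t) \<in> qcong X R" if "s \<in> qterms X" "t \<in> qterms X" for s t
    using eq_equiv_class_iff[OF equiv_qcong that] .
  have div: "\<exists>!z. z \<in> carrier ?P \<and> ?c s = z \<star>\<^bsub>?P\<^esub> ?c t"
    if st: "s \<in> qterms X" "t \<in> qterms X" for s t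
  proof (rule ex1I[of _ "?c (QInv s t)"])
    show "?c (QInv s t) \<in> carrier ?P \<and> ?c s = ?c (QInv s t) \<star>\<^bsub>?P\<^esub> ?c t"
      using st by (auto simp: car presented_qop eq intro: qcong.sym qcong.inv_mul)
  next
    fix z assume z: "z \<in> carrier ?P \<and> ?c s = z \<star>\<^bsub>?P\<^esub> ?c t"
    then obtain u where u: "u \<in> qterms X" "z = ?c u" by (auto simp: car)
    with z st have "(s, QMul u t) \<in> qcong X R" by (simp add: presented_qop eq)
    then have "(QInv s t, QInv (QMul u t) t) \<in> qcong X R"
      using st by (blast intro: qcong.cong_inv qcong.refl)
    then have "(QInv s t, u) \<in> qcong X R"
      using st u by (blast intro: qcong.trans qcong.mul_inv)
    then show "z = ?c (QInv s t)" using st u eq by (simp add: qcong.sym)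
  qed
  show ?thesis
  proof
    obtain a where "a \<in> X" using assms by blast
    then have "?c (QGen a) \<in> carrier ?P" unfolding car by (intro imageI) simp
    then show "carrier ?P \<noteq> {}" by blast
  next
    fix x y assume "x \<in> carrier ?P" "y \<in> carrier ?P"
    then obtain s t where "s \<in> qterms X" "t \<in> qterms X" "x = ?c s" "y = ?c t"
      unfolding car by blast
    then show "x \<star>\<^bsub>?P\<^esub> y \<in> carrier ?P" "\<exists>!z. z \<in> carrier ?P \<and> x = z \<star>\<^bsub>?P\<^esub> y"
      using div[of s t] by (simp_all add: presented_qop) (simp add: car)
  next
    fix x assume "x \<in> carrier ?P"
    then obtain s where "s \<in> qterms X" "x = ?c s"
      unfolding car by blast
    then show "x \<star>\<^bsub>?P\<^esub> x = x"
      by (simp add: presented_qop eq qcong.idem)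
  next
    fix x y z assume "x \<in> carrier ?P" "y \<in> carrier ?P" "z \<in> carrier ?P"
    then obtain s t u where "s \<in> qterms X" "t \<in> qterms X" "u \<in> qterms X"
        "x = ?c s" "y = ?c t" "z = ?c u"
      unfolding car by blast
    then show "(x \<star>\<^bsub>?P\<^esub> y) \<star>\<^bsub>?P\<^esub> z = (x \<star>\<^bsub>?P\<^esub> z) \<star>\<^bsub>?P\<^esub> (y \<star>\<^bsub>?P\<^esub> z)"
      by (simp add: presented_qop eq qcong.distrib)
  qed
qed

primrec qeval :: "('b, 'c) quandle_struct_scheme \<Rightarrow> ('a \<Rightarrow> 'b) \<Rightarrow> 'a qterm \<Rightarrow> 'b" where
  "qeval K f (QGen a) = f a"
| "qeval K f (QMul s t) = qeval K f s \<star>\<^bsub>K\<^esub> qeval K f t"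
| "qeval K f (QInv s t) = quandle_inv K (qeval K f s) (qeval K f t)"

lemma presented_quandle_universal:
  assumes K: "quandle K" and f: "f \<in> X \<rightarrow> carrier K"
    and R: "\<And>s t. (s, t) \<in> R \<Longrightarrow> qeval K f s = qeval K f t"
  obtains h where "h \<in> carrier (presented_quandle X R) \<rightarrow> carrier K"
    and "\<And>a b. \<lbrakk> a \<in> carrier (presented_quandle X R); b \<in> carrier (presented_quandle X R) \<rbrakk>
           \<Longrightarrow> h (a \<star>\<^bsub>presented_quandle X R\<^esub> b) = h a \<star>\<^bsub>K\<^esub> h b"
    and "\<And>x. x \<in> X \<Longrightarrow> h (qcong X R `` {QGen x}) = f x"
proof -
  interpret K: quandle K by fact
  let ?P = "presented_quandle X R" and ?c = "\<lambda>t. qcong X R `` {t}" and ?e = "qeval K f"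
  have inv: "quandle_inv K x y \<in> carrier K \<and> x = quandle_inv K x y \<star>\<^bsub>K\<^esub> y"
    if "x \<in> carrier K" "y \<in> carrier K" for x y
    unfolding quandle_inv_def by (rule theI'[OF K.right_div[OF that]])
  have inv': "quandle_inv K (x \<star>\<^bsub>K\<^esub> y) y = x" if "x \<in> carrier K" "y \<in> carrier K" for x y
    using K.right_div[of "x \<star>\<^bsub>K\<^esub> y" y] K.closed[OF that] that inv by metis
  have ecar: "?e t \<in> carrier K" if "t \<in> qterms X" for t
    using that f by (induction t) (auto simp: K.closed inv)
  have e: "?e s = ?e t" if "(s, t) \<in> qcong X R" for s t
    using that
  proof (induction rule: qcong.induct)
    case (inv_mul s t)
    then show ?case using inv[of "?e s" "?e t"] ecar by simp
  next
    case (mul_inv s t)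
    then show ?case using inv' ecar by simp
  next
    case (idem s)
    then show ?case using K.idem ecar by simp
  next
    case (distrib s t u)
    then show ?case using K.distrib[of "?e s" "?e t" "?e u"] ecar by simp
  next
    case (rel s t)
    then show ?case using R by blast
  qed simp_all
  define h where "h A = ?e (SOME t. t \<in> A)" for A
  have hc: "h (?c t) = ?e t" if "t \<in> qterms X" for t
  proof -
    have "(SOME s. s \<in> ?c t) \<in> ?c t"
      by (rule someI[of _ t]) (use that in \<open>simp add: qcong.refl\<close>)
    then show ?thesis unfolding h_def by (auto dest: e)
  qed
  have car: "carrier ?P = ?c ` qterms X"
    by (auto simp: presented_quandle_def quotient_def)
  show thesis
    by (rule that[of h]) (auto simp: car hc ecar presented_qop)
qed


section \<open>Link quandles\<close>

text \<open>Only the part of an oriented diagram that enters the link quandle is recorded: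
  its arcs and, for each crossing, the over arc, the incoming and the outgoing under arc
  and the sign.\<close>

record 'a crossing =
  over_arc :: 'a
  under_in :: 'a
  under_out :: 'a
  positive :: bool

record 'a diagram =
  arcs :: "'a set"
  crossings :: "'a crossing set"

definition crossing_relation :: "'a crossing \<Rightarrow> 'a qterm \<times> 'a qterm" where
  "crossing_relation c =
     (QGen (under_out c),
      (if positive c then QMul else QInv) (QGen (under_in c)) (QGen (over_arc c)))"

definition link_quandle :: "'a diagram \<Rightarrow> 'a qterm set quandle_struct" where
  "link_quandle D = presented_quandle (arcs D) (crossing_relation ` crossings D)"


section \<open>Closed braids and torus links\<close>

text \<open>A braid word on \<open>m\<close> strands is a list of letters \<open>(i, e)\<close> with \<open>1 \<le> i < m\<close>, standing for
  \<open>\<sigma>\<^sub>i\<close> if \<open>e\<close> holds and for its inverse otherwise. Strands run upwards, with positions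
  \<open>1, \<dots>, m\<close> from left to right, and the \<open>t\<close>-th letter occupies the slab between the levels
  \<open>t\<close> and \<open>t + 1\<close>. In \<open>\<sigma>\<^sub>i\<close> the strand going from position \<open>i\<close> to \<open>i + 1\<close> passes over, which makes
  the crossing positive; in the inverse it passes under, and the crossing is negative.\<close>

type_synonym braid_word = "(nat \<times> bool) list"

text \<open>The points \<open>(t, j)\<close> at which the strands meet the levels.\<close>

definition braid_points :: "nat \<Rightarrow> braid_word \<Rightarrow> (nat \<times> nat) set" where
  "braid_points m w = {0..length w} \<times> {1..m}"

text \<open>Two consecutive points of the closed braid, joined by a piece of strand that does not pass
  under a crossing. The last rule closes the braid.\<close>

inductive joined :: "nat \<Rightarrow> braid_word \<Rightarrow> nat \<times> nat \<Rightarrow> nat \<times> nat \<Rightarrow> bool"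
  for m :: nat and w :: braid_word where
  straight: "\<lbrakk> t < length w; w ! t = (i, e); j \<in> {1..m}; j \<noteq> i; j \<noteq> Suc i \<rbrakk>
              \<Longrightarrow> joined m w (t, j) (Suc t, j)"
| over_positive: "\<lbrakk> t < length w; w ! t = (i, True) \<rbrakk> \<Longrightarrow> joined m w (t, i) (Suc t, Suc i)"
| over_negative: "\<lbrakk> t < length w; w ! t = (i, False) \<rbrakk> \<Longrightarrow> joined m w (t, Suc i) (Suc t, i)"
| closure: "j \<in> {1..m} \<Longrightarrow> joined m w (length w, j) (0, j)"

text \<open>An arc is represented by the set of points that lie on it.\<close>

definition arc_of :: "nat \<Rightarrow> braid_word \<Rightarrow> nat \<times> nat \<Rightarrow> (nat \<times> nat) set" where
  "arc_of m w p = {q. equivclp (joined m w) p q}"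

definition braid_crossing :: "nat \<Rightarrow> braid_word \<Rightarrow> nat \<Rightarrow> (nat \<times> nat) set crossing" where
  "braid_crossing m w t =
     (case w ! t of (i, e) \<Rightarrow>
        if e then
          \<lparr> over_arc = arc_of m w (t, i),
            under_in = arc_of m w (t, Suc i), under_out = arc_of m w (Suc t, i),
            positive = True \<rparr>
        else
          \<lparr> over_arc = arc_of m w (t, Suc i),
            under_in = arc_of m w (t, i), under_out = arc_of m w (Suc t, Suc i),
            positive = False \<rparr>)"

definition closed_braid_diagram :: "nat \<Rightarrow> braid_word \<Rightarrow> (nat \<times> nat) set diagram" where
  "closed_braid_diagram m w =
     \<lparr> arcs = arc_of m w ` braid_points m w,
       crossings = braid_crossing m w ` {..<length w} \<rparr>"

definition torus_braid :: "nat \<Rightarrow> nat \<Rightarrow> braid_word" where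
  "torus_braid m n = concat (replicate n (map (\<lambda>i. (i, True)) [1..<m]))"

definition torus_link_diagram :: "nat \<Rightarrow> nat \<Rightarrow> (nat \<times> nat) set diagram" where
  "torus_link_diagram m n = closed_braid_diagram m (torus_braid m n)"

lemma torus_link_crossings_wf:
  assumes "c \<in> crossings (torus_link_diagram m n)"
  shows "over_arc c \<in> arcs (torus_link_diagram m n)"
    and "under_in c \<in> arcs (torus_link_diagram m n)"
    and "under_out c \<in> arcs (torus_link_diagram m n)"
proof -
  let ?w = "torus_braid m n"
  from assms obtain t where t: "t < length ?w" and c: "c = braid_crossing m ?w t"
    by (auto simp: torus_link_diagram_def closed_braid_diagram_def)
  have "set ?w \<subseteq> (\<lambda>i. (i, True)) ` {1..<m}" by (auto simp: torus_braid_def)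
  then obtain i where i: "?w ! t = (i, True)" "1 \<le> i" "i < m"
    using nth_mem[OF t] by auto
  have p: "(t, i) \<in> braid_points m ?w" "(t, Suc i) \<in> braid_points m ?w"
    "(Suc t, i) \<in> braid_points m ?w"
    using t i by (auto simp: braid_points_def)
  then show "over_arc c \<in> arcs (torus_link_diagram m n)"
    and "under_in c \<in> arcs (torus_link_diagram m n)"
    and "under_out c \<in> arcs (torus_link_diagram m n)"
    using i by (simp_all add: c braid_crossing_def torus_link_diagram_def closed_braid_diagram_def)
qed

lemma torus_link_quandle:
  assumes "m \<ge> 1"
  shows "quandle (link_quandle (torus_link_diagram m n))"
  unfolding link_quandle_def
  by (rule presented_quandle_quandle)
     (use assms in \<open>auto simp: torus_link_diagram_def closed_braid_diagram_def braid_points_def\<close>)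

end

theory Submission
  imports Defs Complex_Main
begin

text \<open>Index the strands of the braid by residues modulo \<open>m\<close> and let \<open>x k j\<close> be the colour at
  position \<open>j\<close> after \<open>k\<close> of the \<open>n\<close> blocks \<open>\<sigma>\<^sub>1 \<cdots> \<sigma>\<^sub>m\<^sub>-\<^sub>1\<close>. Then
  \<open>x (k + 1) j = x k (j + 1) \<star> x k 0\<close>, so that \<open>x n j = W (x 0 (j + n))\<close>, where the product \<open>W\<close> of
  the right translations by \<open>x 0 0, \<dots>, x (n - 1) 0\<close> does not depend on \<open>j\<close>. As the braid is closed,
  \<open>W\<close> maps \<open>x 0 (j + n)\<close> to \<open>x 0 j\<close>, and \<open>W\<^sup>m\<close> fixes \<open>x 0 0\<close>. For a right order \<open>W\<close> is increasing,
  and an increasing map has no periodic points other than fixed points. Hence \<open>x 0 n = x 0 0\<close>.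
  This equality is refuted by a colouring in an Alexander quandle on the complex numbers.\<close>

section \<open>Colourings of positive closed braids\<close>

definition positive_word :: "nat \<Rightarrow> braid_word \<Rightarrow> bool" where
  "positive_word m w \<longleftrightarrow> (\<forall>(i, e) \<in> set w. i \<in> {1..<m} \<and> e)"

text \<open>Colours sit on points rather than arcs, so that each level of the braid can be
  addressed. Invariance under \<open>joined\<close> makes them constant along arcs. The crossing
  rule concerns positive letters, the only ones in a \<open>positive_word\<close>.\<close>

definition coloring ::
    "('a, 'b) quandle_struct_scheme \<Rightarrow> nat \<Rightarrow> braid_word \<Rightarrow> (nat \<times> nat \<Rightarrow> 'a) \<Rightarrow> bool" where
  "coloring Q m w f \<longleftrightarrow>
     f ` braid_points m w \<subseteq> carrier Q \<and>
     (\<forall>p q. joined m w p q \<longrightarrow> f p = f q) \<and>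
     (\<forall>t i. t < length w \<longrightarrow> w ! t = (i, True) \<longrightarrow> f (Suc t, i) = f (t, Suc i) \<star>\<^bsub>Q\<^esub> f (t, i))"

text \<open>This is the universal colouring: by \<open>coloring_factors\<close>, every colouring of
  a positive word in a quandle is a function of it on \<open>braid_points m w\<close>.\<close>

definition arc_generator :: "nat \<Rightarrow> braid_word \<Rightarrow> nat \<times> nat \<Rightarrow> (nat \<times> nat) set qterm set" where
  "arc_generator m w p =
     (let D = closed_braid_diagram m w in
      qcong (arcs D) (crossing_relation ` crossings D) `` {QGen (arc_of m w p)})"

lemma positive_word_nth:
  assumes "positive_word m w" "t < length w"
  obtains i where "w ! t = (i, True)" "1 \<le> i" "i < m"
proof -
  obtain i e where ie: "w ! t = (i, e)" by fastforce
  have "w ! t \<in> set w" using assms(2) by simp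
  with assms(1) ie have "i \<in> {1..<m} \<and> e" unfolding positive_word_def by fastforce
  then show thesis using that ie by simp
qed

lemma arc_of_joined:
  assumes "joined m w p q"
  shows "arc_of m w p = arc_of m w q"
proof -
  have "equivclp (joined m w) p q" using assms by (rule r_into_equivclp)
  then show ?thesis
    unfolding arc_of_def by (blast intro: equivclp_trans equivclp_sym)
qed

lemma coloring_arc:
  assumes f: "coloring Q m w f" and "q \<in> arc_of m w p"
  shows "f q = f p"
proof -
  have "equivclp (joined m w) p q" using assms(2) by (simp add: arc_of_def)
  then show ?thesis
    by (induction rule: equivclp_induct) (use f in \<open>auto simp: coloring_def\<close>)
qed

text \<open>At a positive crossing the relation of the presentation is the colouring rule itself,
  and joined points share one generator.\<close>

lemma arc_generator_coloring:
  assumes w: "positive_word m w"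
  shows "coloring (link_quandle (closed_braid_diagram m w)) m w (arc_generator m w)"
proof -
  let ?D = "closed_braid_diagram m w"
  let ?X = "arcs ?D" and ?R = "crossing_relation ` crossings ?D"
  let ?c = "\<lambda>t. qcong ?X ?R `` {t}"
  have gen: "QGen (arc_of m w p) \<in> qterms ?X" if "p \<in> braid_points m w" for p
    using that by (simp add: closed_braid_diagram_def)
  have "arc_generator m w (Suc t, i) =
      arc_generator m w (t, Suc i) \<star>\<^bsub>link_quandle ?D\<^esub> arc_generator m w (t, i)"
    if t: "t < length w" "w ! t = (i, True)" for t i
  proof -
    have i: "1 \<le> i" "i < m" using positive_word_nth[OF w t(1)] t(2) by auto
    have g: "QGen (arc_of m w (Suc t, i)) \<in> qterms ?X" "QGen (arc_of m w (t, Suc i)) \<in> qterms ?X"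
        "QGen (arc_of m w (t, i)) \<in> qterms ?X"
      using i t by (auto intro!: gen simp del: qterms_simps simp: braid_points_def)
    have "crossing_relation (braid_crossing m w t) \<in> ?R"
      using t(1) by (simp add: closed_braid_diagram_def)
    then have "(QGen (arc_of m w (Suc t, i)),
        QMul (QGen (arc_of m w (t, Suc i))) (QGen (arc_of m w (t, i)))) \<in> ?R"
      using t(2) by (simp add: crossing_relation_def braid_crossing_def)
    then have "?c (QGen (arc_of m w (Suc t, i))) =
        ?c (QMul (QGen (arc_of m w (t, Suc i))) (QGen (arc_of m w (t, i))))"
      using g by (intro equiv_class_eq[OF equiv_qcong] qcong.rel) auto
    then show ?thesis
      using g by (simp add: arc_generator_def Let_def link_quandle_def presented_qop del: qterms_simps)
  qed
  moreover have "arc_generator m w p \<in> carrier (link_quandle ?D)" if "p \<in> braid_points m w" for p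
    using gen[OF that]
    by (simp add: arc_generator_def Let_def link_quandle_def presented_quandle_def quotientI
        del: qterms_simps)
  ultimately show ?thesis
    by (auto simp: coloring_def arc_generator_def dest: arc_of_joined)
qed

text \<open>A colouring descends to arcs and respects every crossing relation, so the universal
  property of the presentation applies. The purpose is to separate generators: points of different
  colours have different classes in the link quandle.\<close>

lemma coloring_factors:
  assumes w: "positive_word m w" and Q: "quandle Q" and f: "coloring Q m w f"
  obtains h where "\<And>p. p \<in> braid_points m w \<Longrightarrow> h (arc_generator m w p) = f p"
proof -
  let ?D = "closed_braid_diagram m w"
  let ?X = "arcs ?D" and ?R = "crossing_relation ` crossings ?D"
  define g where "g A = f (SOME p. p \<in> A)" for A
  have g: "g (arc_of m w p) = f p" for p
  proof -
    have "p \<in> arc_of m w p" by (simp add: arc_of_def)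
    then have "(SOME q. q \<in> arc_of m w p) \<in> arc_of m w p" by (rule someI)
    then show ?thesis unfolding g_def by (rule coloring_arc[OF f])
  qed
  have "g \<in> ?X \<rightarrow> carrier Q"
    using f by (auto simp: closed_braid_diagram_def g coloring_def)
  moreover have "qeval Q g s = qeval Q g t" if "(s, t) \<in> ?R" for s t
  proof -
    have "\<exists>u<length w. (s, t) = crossing_relation (braid_crossing m w u)"
      using that by (auto simp: closed_braid_diagram_def image_iff)
    then obtain u where u: "u < length w" "(s, t) = crossing_relation (braid_crossing m w u)"
      by blast
    obtain i where "w ! u = (i, True)" using positive_word_nth[OF w u(1)] .
    with u f show ?thesis
      by (simp add: crossing_relation_def braid_crossing_def g coloring_def)
  qed
  ultimately obtain h where h: "\<And>x. x \<in> ?X \<Longrightarrow> h (qcong ?X ?R `` {QGen x}) = g x"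
    using presented_quandle_universal[OF Q, of g ?X ?R] by metis
  show thesis
  proof (rule that[of h])
    fix p assume "p \<in> braid_points m w"
    then have "arc_of m w p \<in> ?X" by (simp add: closed_braid_diagram_def)
    then show "h (arc_generator m w p) = f p"
      using h g by (simp add: arc_generator_def Let_def)
  qed
qed

section \<open>Colourings of torus links\<close>

lemma torus_braid_length: "length (torus_braid m n) = n * (m - 1)"
  by (simp add: torus_braid_def length_concat sum_list_replicate)

lemma torus_braid_nth:
  assumes "t < n * (m - 1)"
  shows "torus_braid m n ! t = (Suc (t mod (m - 1)), True)"
  using assms
proof (induction n arbitrary: t)
  case (Suc n)
  have eq: "torus_braid m (Suc n) = map (\<lambda>i. (i, True)) [1..<m] @ torus_braid m n"
    by (simp add: torus_braid_def)
  show ?case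
  proof (cases "t < m - 1")
    case True
    then show ?thesis by (simp add: eq nth_append)
  next
    case False
    then have "t - (m - 1) < n * (m - 1)" using Suc.prems by auto
    from Suc.IH[OF this] False show ?thesis
      by (simp add: eq nth_append le_mod_geq)
  qed
qed simp

lemma torus_braid_positive: "positive_word m (torus_braid m n)"
  by (auto simp: positive_word_def torus_braid_def)

text \<open>The strand that enters a block at position 1 crosses over all the others in turn. Each
  strand it has met is moved one place to the left and acted on by its colour; those still ahead of
  it are untouched.\<close>

lemma torus_coloring_block:
  assumes f: "coloring Q m (torus_braid m n) f" and k: "k < n" and m: "m \<ge> 2" and s: "s \<le> m - 1"
  shows "f (k * (m - 1) + s, Suc s) = f (k * (m - 1), 1) \<and>
    (\<forall>j\<in>{Suc s<..m}. f (k * (m - 1) + s, j) = f (k * (m - 1), j)) \<and>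
    (\<forall>j\<in>{1..s}. f (k * (m - 1) + s, j) = f (k * (m - 1), Suc j) \<star>\<^bsub>Q\<^esub> f (k * (m - 1), 1))"
  using s
proof (induction s)
  case (Suc s)
  let ?w = "torus_braid m n" and ?t = "k * (m - 1) + s"
  have "?t < Suc k * (m - 1)" using Suc.prems by simp
  also have "\<dots> \<le> n * (m - 1)" using k by (intro mult_right_mono) auto
  finally have t: "?t < length ?w" by (simp add: torus_braid_length)
  then have wt: "?w ! ?t = (Suc s, True)"
    using Suc.prems by (simp add: torus_braid_length torus_braid_nth)
  have J: "f p = f q" if "joined m ?w p q" for p q
    using f that unfolding coloring_def by blast
  have IH: "f (?t, Suc s) = f (k * (m - 1), 1)"
    "j \<in> {Suc s<..m} \<Longrightarrow> f (?t, j) = f (k * (m - 1), j)"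
    "j \<in> {1..s} \<Longrightarrow> f (?t, j) = f (k * (m - 1), Suc j) \<star>\<^bsub>Q\<^esub> f (k * (m - 1), 1)" for j
    using Suc by auto
  have st: "f (Suc ?t, j) = f (?t, j)" if "j \<in> {1..m}" "j \<noteq> Suc s" "j \<noteq> Suc (Suc s)" for j
    using J[OF joined.straight[OF t wt that]] by simp
  have over: "f (Suc ?t, Suc (Suc s)) = f (?t, Suc s)"
    using J[OF joined.over_positive[OF t wt]] by simp
  have under: "f (Suc ?t, Suc s) = f (?t, Suc (Suc s)) \<star>\<^bsub>Q\<^esub> f (?t, Suc s)"
    using f t wt by (auto simp: coloring_def)
  have low: "f (Suc ?t, j) = f (k * (m - 1), Suc j) \<star>\<^bsub>Q\<^esub> f (k * (m - 1), 1)"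
    if "j \<in> {1..Suc s}" for j
  proof (cases "j = Suc s")
    case True
    then show ?thesis using under IH(1) IH(2)[of "Suc (Suc s)"] Suc.prems by auto
  next
    case False
    then show ?thesis using that st[of j] IH(3)[of j] Suc.prems by auto
  qed
  have high: "f (Suc ?t, j) = f (k * (m - 1), j)" if "j \<in> {Suc (Suc s)<..m}" for j
    using that st[of j] IH(2)[of j] by auto
  show ?case using over IH(1) low high by simp
qed simp

text \<open>Cyclic indexing, with index \<open>j\<close> at position \<open>Suc (j mod m)\<close>,
  lets a single recursion cover the under strands and the over strand alike.\<close>

lemma torus_coloring_rows:
  assumes Q: "quandle Q" and f: "coloring Q m (torus_braid m n) f" and m: "m \<ge> 2"
  obtains x where "\<And>k j. k \<le> n \<Longrightarrow> x k j \<in> carrier Q"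
    and "\<And>k j. k < n \<Longrightarrow> x (Suc k) j = x k (Suc j) \<star>\<^bsub>Q\<^esub> x k 0"
    and "\<And>k j. x k (j + m) = x k j"
    and "\<And>j. x n j = x 0 j"
    and "\<And>j. x 0 j = f (0, Suc (j mod m))"
proof -
  interpret Q: quandle Q by fact
  define x where "x k j = f (k * (m - 1), Suc (j mod m))" for k j
  have x_car: "x k j \<in> carrier Q" if "k \<le> n" for k j
  proof -
    have "j mod m < m" using m by simp
    moreover have "k * (m - 1) \<le> n * (m - 1)" using that by simp
    ultimately have "(k * (m - 1), Suc (j mod m)) \<in> braid_points m (torus_braid m n)"
      by (simp add: braid_points_def torus_braid_length del: mult_le_cancel2)
    then show ?thesis using f unfolding x_def coloring_def by blast
  qed
  have "x (Suc k) j = x k (Suc j) \<star>\<^bsub>Q\<^esub> x k 0" if k: "k < n" for k j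
  proof -
    have jm: "j mod m < m" using m by simp
    note b = torus_coloring_block[OF f k m order.refl]
    have eq: "Suc k * (m - 1) = k * (m - 1) + (m - 1)" by simp
    show ?thesis
    proof (cases "Suc (j mod m) = m")
      \<comment> \<open>The over strand wraps round from the first position to the last with its
        colour unchanged. By idempotence this agrees with acting on that colour by itself.\<close>
      case True
      then have "x (Suc k) j = x k 0" "x k (Suc j) = x k 0"
        using b m unfolding x_def eq by (simp_all add: mod_Suc)
      then show ?thesis using Q.idem[OF x_car] k by simp
    next
      case False
      then show ?thesis using b jm unfolding x_def eq by (auto simp: mod_Suc)
    qed
  qed
  moreover have "x n j = x 0 j" for j
  proof -
    have "joined m (torus_braid m n) (n * (m - 1), Suc (j mod m)) (0, Suc (j mod m))"
      using joined.closure[of "Suc (j mod m)" m "torus_braid m n"] m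
      by (simp add: torus_braid_length Suc_le_eq)
    then show ?thesis using f by (simp add: x_def coloring_def)
  qed
  ultimately show thesis using that[of x] x_car by (simp add: x_def)
qed

text \<open>Within block \<open>k\<close>, after its first \<open>s\<close> letters, the strands at the positions \<open>1, \<dots>, s\<close> have
  already passed under the strand that is now at position \<open>s + 1\<close>.\<close>

lemma torus_coloring_of_rows:
  assumes m: "m \<ge> 2" and car: "\<And>k j. x k j \<in> carrier Q"
    and step: "\<And>k j. x (Suc k) j = x k (Suc j) \<star>\<^bsub>Q\<^esub> x k 1"
    and last: "\<And>k. x (Suc k) m = x k 1"
    and close: "\<And>j. x n j = x 0 j"
  obtains f where "coloring Q m (torus_braid m n) f"
    and "\<And>j. j \<ge> 1 \<Longrightarrow> f (0, j) = x 0 j"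
proof -
  define f where "f = (\<lambda>(t, j). let k = t div (m - 1); s = t mod (m - 1) in
    if j \<le> s then x (Suc k) j else if j = Suc s then x k 1 else x k j)"
  let ?w = "torus_braid m n"
  have f_eq: "f (k * (m - 1) + s, j) =
      (if j \<le> s then x (Suc k) j else if j = Suc s then x k 1 else x k j)"
    if "s \<le> m - 1" "1 \<le> j" "j \<le> m" for k s j
  proof (cases "s = m - 1")
    case True
    then have eq: "k * (m - 1) + s = Suc k * (m - 1)" by simp
    have "Suc k * (m - 1) div (m - 1) = Suc k" "Suc k * (m - 1) mod (m - 1) = 0"
      using m by (simp_all only: nonzero_mult_div_cancel_right mod_mult_self2_is_0)
    then have "f (k * (m - 1) + s, j) = x (Suc k) j"
      using \<open>1 \<le> j\<close> unfolding f_def eq case_prod_conv Let_def by simp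
    moreover have "x (Suc k) j = x k 1 \<and> j = Suc s" if "\<not> j \<le> s"
    proof -
      have "j = m" "j = Suc s" using that True \<open>j \<le> m\<close> by simp_all
      then show ?thesis using last by metis
    qed
    ultimately show ?thesis by (cases "j \<le> s") simp_all
  next
    case False
    then have "s < m - 1" using that by simp
    then have "(k * (m - 1) + s) div (m - 1) = k" "(k * (m - 1) + s) mod (m - 1) = s"
      by simp_all
    then show ?thesis unfolding f_def case_prod_conv Let_def by simp
  qed
  have cross: "\<exists>k s. s < m - 1 \<and> t = k * (m - 1) + s \<and> i = Suc s \<and> e"
    if "t < length ?w" "?w ! t = (i, e)" for t i e
  proof (intro exI conjI)
    show "t mod (m - 1) < m - 1" using m by simp
    show "t = t div (m - 1) * (m - 1) + t mod (m - 1)"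
      by (rule div_mult_mod_eq[symmetric])
    show "i = Suc (t mod (m - 1))" "e"
      using torus_braid_nth[of t n m] that unfolding torus_braid_length by simp_all
  qed
  have "f p = f q" if "joined m ?w p q" for p q
    using that
  proof cases
    case (straight t i e j)
    obtain k s where "s < m - 1" "t = k * (m - 1) + s" "i = Suc s"
      using cross[OF straight(3,4)] by blast
    then show ?thesis using straight f_eq[of s j k] f_eq[of "Suc s" j k] by auto
  next
    case (over_positive t i)
    obtain k s where "s < m - 1" "t = k * (m - 1) + s" "i = Suc s"
      using cross[OF over_positive(3,4)] by blast
    then show ?thesis
      using over_positive f_eq[of s "Suc s" k] f_eq[of "Suc s" "Suc (Suc s)" k] by auto
  next
    case (over_negative t i)
    then show ?thesis using cross by blast
  next
    case (closure j)
    then show ?thesis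
      using f_eq[of 0 j n] f_eq[of 0 j 0] close by (simp add: torus_braid_length)
  qed
  moreover have "f (Suc t, i) = f (t, Suc i) \<star>\<^bsub>Q\<^esub> f (t, i)"
    if t: "t < length ?w" "?w ! t = (i, True)" for t i
  proof -
    obtain k s where "s < m - 1" "t = k * (m - 1) + s" "i = Suc s"
      using cross[OF t] by blast
    then show ?thesis
      using f_eq[of s "Suc s" k] f_eq[of s "Suc (Suc s)" k] f_eq[of "Suc s" "Suc s" k] step by auto
  qed
  moreover have "f p \<in> carrier Q" for p
    by (simp add: f_def Let_def car split: prod.split)
  ultimately have "coloring Q m ?w f" by (auto simp: coloring_def)
  moreover have "f (0, j) = x 0 j" if "j \<ge> 1" for j
    using that by (auto simp: f_def)
  ultimately show thesis using that by blast
qed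

section \<open>Right-orderable quandles\<close>

text \<open>If \<open>a\<close> lay below \<open>V a\<close>, monotonicity and transitivity would
  keep it below every later iterate, hence below itself. The opposite case is symmetric.\<close>

lemma increasing_periodic_imp_fixed:
  assumes r: "strict_linear_order_on A r" and V: "V \<in> A \<rightarrow> A"
    and mono: "\<And>a b. \<lbrakk> a \<in> A; b \<in> A; (a, b) \<in> r \<rbrakk> \<Longrightarrow> (V a, V b) \<in> r"
    and a: "a \<in> A" and per: "(V ^^ m) a = a" and m: "m > 0"
  shows "V a = a"
proof (rule ccontr)
  have tr: "trans r" and irr: "irrefl r" and tot: "total_on A r"
    using r by (auto simp: strict_linear_order_on_def)
  have A: "(V ^^ i) a \<in> A" for i
    by (induction i) (use a V in auto)
  assume "V a \<noteq> a"
  then consider "(a, V a) \<in> r" | "(V a, a) \<in> r"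
    using tot a V by (auto simp: total_on_def Pi_iff)
  then show False
  proof cases
    case 1
    have "(a, (V ^^ Suc i) a) \<in> r" for i
    proof (induction i)
      case (Suc i)
      from mono[OF a A this] show ?case using 1 tr by (auto elim: transE)
    qed (use 1 in simp)
    from this[of "m - 1"] per m irr show False by (simp add: irrefl_def)
  next
    case 2
    have "((V ^^ Suc i) a, a) \<in> r" for i
    proof (induction i)
      case (Suc i)
      from mono[OF A a this] show ?case using 2 tr by (auto elim: transE)
    qed (use 2 in simp)
    from this[of "m - 1"] per m irr show False by (simp add: irrefl_def)
  qed
qed

lemma right_orderable_torus_rows:
  assumes Q: "quandle Q" and "right_orderable Q" and m: "m > 0"
    and car: "\<And>k j. k \<le> n \<Longrightarrow> x k j \<in> carrier Q"
    and step: "\<And>k j. k < n \<Longrightarrow> x (Suc k) j = x k (Suc j) \<star>\<^bsub>Q\<^esub> x k 0"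
    and period: "\<And>k j. x k (j + m) = x k j"
    and close: "\<And>j. x n j = x 0 j"
  shows "x 0 n = x 0 0"
proof -
  interpret Q: quandle Q by fact
  obtain r where r: "strict_linear_order_on (carrier Q) r"
    and mono: "\<And>a b c. \<lbrakk> a \<in> carrier Q; b \<in> carrier Q; c \<in> carrier Q; (a, b) \<in> r \<rbrakk>
      \<Longrightarrow> (a \<star>\<^bsub>Q\<^esub> c, b \<star>\<^bsub>Q\<^esub> c) \<in> r"
    using assms(2) unfolding right_orderable_def by blast
  \<comment> \<open>The map \<open>V n\<close> is the \<open>W\<close> of the opening outline, built
    one right translation at a time.\<close>
  define V where "V k = rec_nat id (\<lambda>i v z. v z \<star>\<^bsub>Q\<^esub> x i 0) k" for k
  have V_simps: "V 0 = id" "V (Suc k) = (\<lambda>z. V k z \<star>\<^bsub>Q\<^esub> x k 0)" for k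
    by (simp_all add: V_def)
  have V_car: "V k \<in> carrier Q \<rightarrow> carrier Q" if "k \<le> n" for k
    using that by (induction k) (auto simp: V_simps Pi_iff intro!: Q.closed car)
  have V_mono: "(V k a, V k b) \<in> r"
    if "k \<le> n" "a \<in> carrier Q" "b \<in> carrier Q" "(a, b) \<in> r" for k a b
    using that
  proof (induction k)
    case (Suc k)
    then show ?case using V_car[of k] car by (auto simp: V_simps Pi_iff intro!: mono)
  qed (simp add: V_simps)
  \<comment> \<open>The acting colour \<open>x k 0\<close> is the same for all \<open>j\<close>, so
    each block merely shifts the index by one and appends one translation.\<close>
  have V_x: "V k (x 0 (j + k)) = x k j" if "k \<le> n" for k j
    using that
  proof (induction k arbitrary: j)
    case (Suc k)
    from Suc.IH[of "Suc j"] Suc.prems show ?case by (simp add: V_simps step)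
  qed (simp add: V_simps)
  have shift: "V n (x 0 (j + n)) = x 0 j" for j
    using V_x[of n j] close by simp
  have iter: "(V n ^^ i) (x 0 (j + i * n)) = x 0 j" for i j
  proof (induction i arbitrary: j)
    case (Suc i)
    from Suc[of "j + n"] show ?case by (simp add: add.assoc shift)
  qed simp
  have per: "x 0 (j + i * m) = x 0 j" for i j
    by (induction i) (use period in \<open>simp_all flip: add.assoc add: add.commute[of m]\<close>)
  \<comment> \<open>The index \<open>m * n\<close> is a whole number of periods and also
    \<open>m\<close> shifts by \<open>n\<close>, which makes \<open>x 0 0\<close> a periodic point
    of \<open>V n\<close>.\<close>
  have "x 0 (m * n) = x 0 0" using per[of 0 n] by (simp add: mult.commute)
  then have "(V n ^^ m) (x 0 0) = x 0 0" using iter[of m 0] by simp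
  then have fixed: "V n (x 0 0) = x 0 0"
    by (intro increasing_periodic_imp_fixed[OF r V_car[OF order.refl] V_mono]) (use car m in auto)
  have "(V n ^^ i) (x 0 0) = x 0 0" for i
    by (induction i) (simp_all add: fixed)
  \<comment> \<open>Starting again from index \<open>m * n\<close> but stopping one application
    early ends at index \<open>n\<close> instead of 0.\<close>
  moreover have "(V n ^^ (m - 1)) (x 0 0) = x 0 n"
  proof -
    have "n + (m - 1) * n = m * n" using m by (cases m) simp_all
    then show ?thesis using iter[of "m - 1" n] \<open>x 0 (m * n) = x 0 0\<close> by simp
  qed
  ultimately show ?thesis by simp
qed

section \<open>Alexander quandles\<close>

definition alexander :: "'a::field \<Rightarrow> 'a quandle_struct" where
  "alexander t = \<lparr> carrier = UNIV, qop = (\<lambda>x y. t * x + (1 - t) * y) \<rparr>"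

lemma alexander_quandle:
  assumes "t \<noteq> 0"
  shows "quandle (alexander t)"
proof
  fix x y :: 'a
  show "\<exists>!z. z \<in> carrier (alexander t) \<and> x = z \<star>\<^bsub>alexander t\<^esub> y"
    using assms
    by (intro ex1I[of _ "(x - (1 - t) * y) / t"]) (auto simp: alexander_def field_simps)
qed (auto simp: alexander_def algebra_simps)

text \<open>Let \<open>t = \<eta> / \<zeta>\<close>. Up to an affine map, \<open>x k j\<close> is the result of prescribing the colours
  \<open>\<zeta>\<^sup>j\<close> at the bottom of the braid.\<close>

lemma torus_alexander_coloring:
  fixes \<zeta> \<eta> :: "'a::field"
  assumes m: "m \<ge> 2" and \<zeta>: "\<zeta> ^ m = 1" and \<eta>: "\<eta> ^ n = 1"
  obtains f where "coloring (alexander (\<eta> / \<zeta>)) m (torus_braid m n) f"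
    and "\<And>j. j \<ge> 1 \<Longrightarrow> f (0, j) = (\<eta> - 1) * \<zeta> ^ j + \<zeta> - \<eta>"
proof -
  have nz: "\<zeta> \<noteq> 0" using \<zeta> m by (auto simp: power_0_left)
  define x where "x k j = \<eta> ^ k * ((\<eta> - 1) * \<zeta> ^ j + \<zeta> - \<eta>)" for k j
  \<comment> \<open>The constant term \<open>\<zeta> - \<eta>\<close> is chosen so that a whole
    block multiplies every colour by \<open>\<eta>\<close>; the rows then close up because
    \<open>\<eta> ^ n = 1\<close>.\<close>
  have "x (Suc k) j = x k (Suc j) \<star>\<^bsub>alexander (\<eta> / \<zeta>)\<^esub> x k 1" for k j
    using nz by (simp add: x_def alexander_def field_simps)
  moreover have "x (Suc k) m = x k 1" for k
    by (simp add: x_def \<zeta> algebra_simps)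
  moreover have "x n j = x 0 j" for j by (simp add: x_def \<eta>)
  moreover have "x k j \<in> carrier (alexander (\<eta> / \<zeta>))" for k j by (simp add: alexander_def)
  ultimately obtain f where "coloring (alexander (\<eta> / \<zeta>)) m (torus_braid m n) f"
    and "\<And>j. j \<ge> 1 \<Longrightarrow> f (0, j) = x 0 j"
    using torus_coloring_of_rows[OF m] by metis
  then show thesis using that by (simp add: x_def)
qed

lemma primitive_root_of_unity_exists:
  assumes "m > 0"
  obtains z :: complex where "z ^ m = 1" and "\<And>k. z ^ k = 1 \<Longrightarrow> m dvd k"
proof (rule that[of "cis (2 * pi / m)"])
  show "cis (2 * pi / m) ^ m = 1" using assms by (simp add: DeMoivre)
next
  fix k assume "cis (2 * pi / m) ^ k = 1"
  \<comment> \<open>The real part alone determines the angle here, since \<open>cos\<close> equals 1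
    exactly at the multiples of \<open>2 * pi\<close>.\<close>
  then have "cos (k * (2 * pi / m)) = 1" by (simp add: DeMoivre complex_eq_iff)
  then obtain i :: int where "k * (2 * pi / m) = i * 2 * pi"
    by (auto simp: cos_one_2pi_int)
  then have "real k = real_of_int i * m" using assms by (simp add: field_simps)
  then have "int k = i * int m"
    by (metis of_int_eq_iff of_int_mult of_int_of_nat_eq)
  then show "m dvd k" by (metis dvd_triv_right int_dvd_int_iff)
qed

theorem theorem7p2:
  fixes m n :: nat
  assumes "m \<ge> 2" and "n \<ge> 2"
    and "\<not> m dvd n" and "\<not> n dvd m"
  shows "\<not> right_orderable (link_quandle (torus_link_diagram m n))"
proof
  let ?w = "torus_braid m n"
  let ?Q = "link_quandle (torus_link_diagram m n)" and ?g = "arc_generator m ?w"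
  assume ord: "right_orderable ?Q"
  have Q: "quandle ?Q" by (rule torus_link_quandle) (use assms in simp)
  have "coloring ?Q m ?w ?g"
    unfolding torus_link_diagram_def by (rule arc_generator_coloring[OF torus_braid_positive])
  from torus_coloring_rows[OF Q this assms(1)]
  obtain x where x: "\<And>k j. k \<le> n \<Longrightarrow> x k j \<in> carrier ?Q"
    "\<And>k j. k < n \<Longrightarrow> x (Suc k) j = x k (Suc j) \<star>\<^bsub>?Q\<^esub> x k 0"
    "\<And>k j. x k (j + m) = x k j" "\<And>j. x n j = x 0 j"
    and x0: "\<And>j. x 0 j = ?g (0, Suc (j mod m))"
    by blast
  have "x 0 n = x 0 0"
    by (rule right_orderable_torus_rows[OF Q ord _ x]) (use assms in auto)
  \<comment> \<open>The order has now identified the generators at two bottom points; the rest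
    exhibits a colouring that tells them apart.\<close>
  then have g: "?g (0, Suc (n mod m)) = ?g (0, 1)" by (simp add: x0)
  obtain \<zeta> :: complex where \<zeta>: "\<zeta> ^ m = 1" "\<And>k. \<zeta> ^ k = 1 \<Longrightarrow> m dvd k"
    using primitive_root_of_unity_exists[of m] assms(1) by auto
  obtain \<eta> :: complex where \<eta>: "\<eta> ^ n = 1" "\<And>k. \<eta> ^ k = 1 \<Longrightarrow> n dvd k"
    using primitive_root_of_unity_exists[of n] assms(2) by auto
  \<comment> \<open>This keeps the coefficient of \<open>\<zeta> ^ j\<close> in the colouring from
    vanishing.\<close>
  have "\<eta> \<noteq> 1" using \<eta>(2)[of 1] assms(2) by auto
  have "\<zeta> \<noteq> 0" "\<eta> \<noteq> 0" using \<zeta>(1) \<eta>(1) assms by (auto simp: power_0_left)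
  then have K: "quandle (alexander (\<eta> / \<zeta>))" by (intro alexander_quandle) simp
  obtain f where f: "coloring (alexander (\<eta> / \<zeta>)) m ?w f"
    and f0: "\<And>j. j \<ge> 1 \<Longrightarrow> f (0, j) = (\<eta> - 1) * \<zeta> ^ j + \<zeta> - \<eta>"
    using torus_alexander_coloring[OF assms(1) \<zeta>(1) \<eta>(1)] by auto
  obtain h where h: "\<And>p. p \<in> braid_points m ?w \<Longrightarrow> h (?g p) = f p"
    using coloring_factors[OF torus_braid_positive K f] by blast
  have "n mod m < m" using assms(1) by simp
  then have "(0, Suc (n mod m)) \<in> braid_points m ?w" "(0, 1) \<in> braid_points m ?w"
    using assms(1) by (simp_all add: braid_points_def Suc_le_eq)
  then have "f (0, Suc (n mod m)) = f (0, 1)" using g h by metis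
  \<comment> \<open>Equal colours give \<open>(\<eta> - 1) * \<zeta> ^ Suc (n mod m) = (\<eta> - 1)
    * \<zeta>\<close>, from which both nonzero factors cancel. Primitivity of \<open>\<zeta>\<close>
    then forces \<open>m dvd n\<close>.\<close>
  then have "\<zeta> ^ (n mod m) = 1" using f0 \<open>\<eta> \<noteq> 1\<close> \<open>\<zeta> \<noteq> 0\<close> by simp
  then show False using \<zeta>(2) assms(3) by (metis dvd_mod_iff dvd_refl)
qed

end
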